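(* Let $\mathcal{H}$ be a real Hilbert space and let $A,B:\mathcal{H}\to2^{\mathcal{H}}$ be maximally monotone operators with $\operatorname{Zer}(A+B)\neq\emptyset$. Let $x_1\in\mathcal{H}$, $\gamma>0$, and for each $n\in\mathbb{N}$ define $$\begin{aligned} y_n&=J_{\gamma B}(e_nx_n),\\ z_n&=J_{\gamma A}(2y_n-e_nx_n),\\ u_n&=e_nx_n+\theta_n(z_n-y_n),\\ x_{n+1}&=(2J_{\gamma A}-\mathrm{Id})(2J_{\gamma B}-\mathrm{Id})u_n, \end{aligned}$$ where $e_n\in(0,1)$ and $\theta_n\in(0,2]$ satisfy: $\lim_{n\to\infty}e_n=1$, $\sum_{n=1}^{\infty}(1-e_n)=\infty$, $\sum_{n=2}^{\infty}|e_n-e_{n-1}|<\infty$, and there are constants $\underline{\Theta},\overline{\Theta}$ with $$0<\underline{\Theta}\le\frac{\theta_n}{2}\le\overline{\Theta}<1\ \text{ for all } n\in\mathbb{N},\qquad\sum_{n=2}^{\infty}|\theta_n-\theta_{n-1}|<\infty.$$ Then: (i) $\{x_n\}$ converges strongly to $\bar x=\operatorname{proj}_{\operatorname{Fix}(R_{\gamma A}R_{\gamma B})}(0)$; (ii) $\{y_n\}$ and $\{z_n\}$ converge strongly to $J_{\gamma B}(\bar x)\in\operatorname{Zer}(A+B)$.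
   Context: $\mathbb{N}=\{1,2,\dots\}$. A set-valued operator $A:\mathcal{H}\to2^{\mathcal{H}}$ is monotone if $\langle x-y,u-v\rangle\ge0$ for all $(x,u),(y,v)$ in its graph, and maximally monotone if no monotone operator has a graph properly containing its graph. $J_A=(\mathrm{Id}+A)^{-1}$ is the resolvent and $R_A=2J_A-\mathrm{Id}$ the reflected resolvent. $\operatorname{Zer}(T)=\{x:0\in Tx\}$; $\operatorname{Fix}(T)$ is the set of fixed points of $T$. $\operatorname{proj}_C$ is the metric projection onto a nonempty closed convex set $C$. Strong convergence means convergence in norm. *)

theory Defs
  imports "HOL-Analysis.Analysis"
begin

type_synonym 'a operator = "'a \<Rightarrow> 'a set"

definition op_graph :: "'a operator \<Rightarrow> ('a \<times> 'a) set" where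
  "op_graph A = {(x, u). u \<in> A x}"

definition monotone_op :: "'a::real_inner operator \<Rightarrow> bool" where
  "monotone_op A \<longleftrightarrow>
     (\<forall>(x, u)\<in>op_graph A. \<forall>(y, v)\<in>op_graph A. inner (x - y) (u - v) \<ge> 0)"

definition maximally_monotone :: "'a::real_inner operator \<Rightarrow> bool" where
  "maximally_monotone A \<longleftrightarrow>
     monotone_op A \<and> \<not> (\<exists>B. monotone_op B \<and> op_graph A \<subset> op_graph B)"

definition op_id :: "'a operator" where
  "op_id x = {x}"

text \<open>The sum on the right is the Minkowski sum of sets.\<close>

definition op_add :: "'a::plus operator \<Rightarrow> 'a operator \<Rightarrow> 'a operator" where
  "op_add A B x = A x + B x"

definition op_scale :: "real \<Rightarrow> 'a::real_vector operator \<Rightarrow> 'a operator" where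
  "op_scale c A x = (\<lambda>u. c *\<^sub>R u) ` A x"

definition op_inverse :: "'a operator \<Rightarrow> 'a operator" where
  "op_inverse A u = {x. u \<in> A x}"

definition Zer :: "'a::zero operator \<Rightarrow> 'a set" where
  "Zer T = {x. 0 \<in> T x}"

definition Fix :: "('a \<Rightarrow> 'a) \<Rightarrow> 'a set" where
  "Fix T = {x. T x = x}"

text \<open>
  The resolvent is read as a point-valued map: by Minty's theorem, for maximally monotone
  \<open>A\<close> every value of \<open>(Id + A)\<^sup>-\<^sup>1\<close> is a singleton, whose element is selected here.
\<close>

definition resolvent :: "'a::real_vector operator \<Rightarrow> 'a \<Rightarrow> 'a" where
  "resolvent A x = the_elem (op_inverse (op_add op_id A) x)"

definition reflected_resolvent :: "'a::real_vector operator \<Rightarrow> 'a \<Rightarrow> 'a" where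
  "reflected_resolvent A x = 2 *\<^sub>R resolvent A x - x"

text \<open>
  Library constant \<open>closest_point\<close> is restricted to class \<open>heine_borel\<close>, i.e. to finite
  dimension, hence not usable in a general Hilbert space.
\<close>

definition metric_proj :: "'a::metric_space set \<Rightarrow> 'a \<Rightarrow> 'a" where
  "metric_proj C x = (THE p. p \<in> C \<and> (\<forall>q\<in>C. dist x p \<le> dist x q))"

end

theory Submission
  imports Defs
begin

text \<open>
  With \<open>T = R\<^sub>A R\<^sub>B\<close> and \<open>w\<^sub>n = e\<^sub>n x\<^sub>n\<close>, the identity \<open>z\<^sub>n - y\<^sub>n = (T w\<^sub>n - w\<^sub>n) / 2\<close> turns the scheme into
  \<open>x\<^sub>n\<^sub>+\<^sub>1 = T (w\<^sub>n + \<theta>\<^sub>n/2 (T w\<^sub>n - w\<^sub>n))\<close> with \<open>T\<close> nonexpansive. The factor \<open>e\<^sub>n\<close> pulls the iterates towards \<open>0\<close>: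
  for the fixed point \<open>v\<close> of least norm,
  \<open>norm (x\<^sub>n\<^sub>+\<^sub>1 - v)^2 \<le> e\<^sub>n norm (x\<^sub>n - v)^2 + 2 (1 - e\<^sub>n) <v, v - w\<^sub>n>\<close>, so it suffices that
  \<open>limsup <v, v - w\<^sub>n> \<le> 0\<close>. Since \<open>T w\<^sub>n - w\<^sub>n\<close> tends to \<open>0\<close>, this follows without weak compactness by
  comparing \<open>w\<^sub>n\<close> with Browder's curve \<open>a v\<^sub>a + (v\<^sub>a - T v\<^sub>a) = 0\<close>, which converges strongly to \<open>v\<close>.
\<close>

section \<open>Minty's theorem\<close>

text \<open>The direct method without weak compactness: strong convexity of the square makes a
  minimising sequence Cauchy in its first component. \<open>E\<close> serves as the epigraph of a
  convex lower semicontinuous function, so that no extended real values occur.\<close>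

lemma quadratic_min_variational:
  fixes E :: "('h::{real_inner, banach} \<times> real) set"
  assumes "convex E" and "closed E" and "E \<noteq> {}"
    and bdd: "\<And>w r. (w, r) \<in> E \<Longrightarrow> c \<le> r + (norm w)\<^sup>2 / 2"
  obtains w0 r0 where "(w0, r0) \<in> E"
    and "\<And>w r. (w, r) \<in> E \<Longrightarrow> r0 \<le> r + inner w0 (w - w0)"
proof -
  define f where "f p = snd p + (norm (fst p))\<^sup>2 / 2" for p :: "'h \<times> real"
  define m where "m = Inf (f ` E)"
  have bb: "bdd_below (f ` E)"
    by (rule bdd_belowI[of _ c]) (use bdd in \<open>auto simp: f_def\<close>)
  have m_le: "m \<le> f p" if "p \<in> E" for p
    unfolding m_def by (rule cInf_lower) (use that bb in auto)
  have "\<exists>p\<in>E. f p < m + inverse (Suc n)" for n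
  proof -
    have "Inf (f ` E) < m + inverse (Suc n)" by (simp add: m_def)
    then show ?thesis using assms(3) bb by (subst (asm) cInf_less_iff) auto
  qed
  then obtain P where PE: "\<And>n. P n \<in> E" and Pm: "\<And>n. f (P n) < m + inverse (Suc n)"
    by metis
  \<comment> \<open>The parallelogram law: the left side is exactly \<open>f p + f q\<close> minus
    twice the value of \<open>f\<close> at the midpoint, which lies in \<open>E\<close>.\<close>
  have gap: "(norm (fst p - fst q))\<^sup>2 / 4 \<le> f p + f q - 2 * m" if "p \<in> E" "q \<in> E" for p q
  proof -
    have "(1/2) *\<^sub>R p + (1/2) *\<^sub>R q \<in> E"
      using convexD[OF assms(1) that, of "1/2" "1/2"] by simp
    from m_le[OF this] show ?thesis
      by (simp add: f_def power2_norm_eq_inner inner_simps inner_commute field_simps)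
  qed
  have inv0: "(\<lambda>n. inverse (real (Suc n))) \<longlonglongrightarrow> 0" by (rule LIMSEQ_inverse_real_of_nat)
  have "Cauchy (\<lambda>n. fst (P n))"
  proof (rule metric_CauchyI)
    fix \<epsilon> :: real assume \<epsilon>: "\<epsilon> > 0"
    \<comment> \<open>By \<open>gap\<close>, two excesses below \<epsilon>^2/8 give a squared
      distance below 4 * (2 * \<epsilon>^2/8) = \<epsilon>^2.\<close>
    then have "eventually (\<lambda>n. inverse (real (Suc n)) < \<epsilon>\<^sup>2 / 8) sequentially"
      by (intro order_tendstoD[OF inv0]) simp
    then obtain N where N: "\<And>n. n \<ge> N \<Longrightarrow> inverse (real (Suc n)) < \<epsilon>\<^sup>2 / 8"
      by (auto simp: eventually_sequentially)
    show "\<exists>M. \<forall>i\<ge>M. \<forall>j\<ge>M. dist (fst (P i)) (fst (P j)) < \<epsilon>"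
    proof (intro exI[of _ N] allI impI)
      fix i j assume "i \<ge> N" "j \<ge> N"
      then have "(norm (fst (P i) - fst (P j)))\<^sup>2 < \<epsilon>\<^sup>2"
        using gap[OF PE PE, of i j] Pm[of i] Pm[of j] N[of i] N[of j] by argo
      then show "dist (fst (P i)) (fst (P j)) < \<epsilon>"
        using \<epsilon> by (simp add: dist_norm power2_less_imp_less)
    qed
  qed
  then obtain w0 where w0: "(\<lambda>n. fst (P n)) \<longlonglongrightarrow> w0"
    using Cauchy_convergent_iff convergent_def by blast
  have "(\<lambda>n. f (P n)) \<longlonglongrightarrow> m"
  proof (rule tendsto_sandwich[of "\<lambda>_. m" _ _ "\<lambda>n. m + inverse (Suc n)"])
    show "(\<lambda>n. m + inverse (real (Suc n))) \<longlonglongrightarrow> m"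
      using tendsto_add[OF tendsto_const[of m] inv0] by simp
      show "eventually (\<lambda>n. f (P n) \<le> m + inverse (real (Suc n))) sequentially"
      using Pm by (intro always_eventually allI less_imp_le)
  qed (use m_le[OF PE] in auto)
  then have "(\<lambda>n. f (P n) - (norm (fst (P n)))\<^sup>2 / 2) \<longlonglongrightarrow> m - (norm w0)\<^sup>2 / 2"
    by (intro tendsto_intros w0) auto
  then have r0: "(\<lambda>n. snd (P n)) \<longlonglongrightarrow> m - (norm w0)\<^sup>2 / 2" (is "_ \<longlonglongrightarrow> ?r0")
    by (simp add: f_def)
  have "P \<longlonglongrightarrow> (w0, ?r0)"
    using tendsto_Pair[OF w0 r0] by simp
  then have mem: "(w0, ?r0) \<in> E"
    using assms(2) PE closed_sequentially by blast
  \<comment> \<open>Compare the minimiser with the point at parameter \<open>t\<close> on the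
    segment towards \<open>(w, r)\<close>, divide by \<open>t\<close>, and let \<open>t\<close>
    decrease to 0, which removes the quadratic term.\<close>
  have "?r0 \<le> r + inner w0 (w - w0)" if "(w, r) \<in> E" for w r
  proof (rule tendsto_lowerbound)
    show "((\<lambda>t. r + inner w0 (w - w0) + t * (norm (w - w0))\<^sup>2 / 2) \<longlongrightarrow> r + inner w0 (w - w0)) (at_right 0)"
      by (auto intro!: tendsto_eq_intros)
    show "eventually (\<lambda>t. ?r0 \<le> r + inner w0 (w - w0) + t * (norm (w - w0))\<^sup>2 / 2) (at_right 0)"
      using eventually_at_right_less[of "0::real"] eventually_at_right_real[OF zero_less_one]
    proof eventually_elim
      case (elim t)
      then have t: "0 < t" "t < 1" by auto
      have "(1 - t) *\<^sub>R (w0, ?r0) + t *\<^sub>R (w, r) \<in> E"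
        using convexD[OF assms(1) mem that, of "1 - t" t] t by simp
      then have "m \<le> f ((1 - t) *\<^sub>R (w0, ?r0) + t *\<^sub>R (w, r))" by (rule m_le)
      moreover have "(1 - t) *\<^sub>R (w0, ?r0) + t *\<^sub>R (w, r) = (w0 + t *\<^sub>R (w - w0), ?r0 + t * (r - ?r0))"
        by (simp add: algebra_simps add_divide_distrib diff_divide_distrib)
      ultimately have "m \<le> ?r0 + t * (r - ?r0) + (norm (w0 + t *\<^sub>R (w - w0)))\<^sup>2 / 2"
        by (simp add: f_def)
      moreover have "(norm (w0 + t *\<^sub>R (w - w0)))\<^sup>2
          = (norm w0)\<^sup>2 + 2 * t * inner w0 (w - w0) + t * t * (norm (w - w0))\<^sup>2"
        by (simp only: power2_norm_eq_inner)
          (simp only: inner_add_left inner_add_right inner_scaleR_left inner_scaleR_right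
            inner_commute[of "w - w0" w0], algebra)
      ultimately have "0 \<le> t * (r - ?r0 + inner w0 (w - w0) + t * (norm (w - w0))\<^sup>2 / 2)"
        by (simp add: algebra_simps)
      then show ?case
        using t by (simp add: zero_le_mult_iff)
    qed
  qed simp
  with mem show thesis by (rule that)
qed

section \<open>Maximality via monotonically related pairs; scaling and translation\<close>

lemma monotone_opD:
  assumes "monotone_op A" "u \<in> A x" "v \<in> A y"
  shows "0 \<le> inner (x - y) (u - v)"
  using assms by (auto simp: monotone_op_def op_graph_def)

text \<open>A pair monotonically related to the whole graph can be adjoined without losing
  monotonicity, so a maximal graph must already contain it.\<close>

lemma maximally_monotone_iff:
  "maximally_monotone A \<longleftrightarrow> monotone_op A \<and>
     (\<forall>x u. (\<forall>y v. v \<in> A y \<longrightarrow> 0 \<le> inner (x - y) (u - v)) \<longrightarrow> u \<in> A x)"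
  (is "_ \<longleftrightarrow> _ \<and> ?max")
proof (intro iffI conjI)
  assume A: "maximally_monotone A"
  then show mono: "monotone_op A" by (simp add: maximally_monotone_def)
  show ?max
  proof (intro allI impI)
    fix x u assume rel: "\<forall>y v. v \<in> A y \<longrightarrow> 0 \<le> inner (x - y) (u - v)"
    show "u \<in> A x"
    proof (rule ccontr)
      assume nin: "u \<notin> A x"
      define B where "B = A(x := insert u (A x))"
      have B: "op_graph B = insert (x, u) (op_graph A)"
        by (auto simp: B_def op_graph_def split: if_splits)
      have "0 \<le> inner (y - x) (v - u)" if "v \<in> A y" for y v
        using rel that inner_minus_left[of "x - y" "v - u"] inner_minus_right[of "x - y" "u - v"]
        by (metis minus_diff_eq minus_minus)
      then have "monotone_op B"
        using mono rel unfolding monotone_op_def B by (auto simp: op_graph_def)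
      moreover have "op_graph A \<subset> op_graph B"
        using nin unfolding B by (auto simp: op_graph_def)
      ultimately show False using A by (auto simp: maximally_monotone_def)
    qed
  qed
next
  assume A: "monotone_op A \<and> ?max"
  have "op_graph B \<subseteq> op_graph A" if "monotone_op B" "op_graph A \<subset> op_graph B" for B
  proof safe
    fix x u assume "(x, u) \<in> op_graph B"
    then have "\<forall>y v. v \<in> A y \<longrightarrow> 0 \<le> inner (x - y) (u - v)"
      using that(2) by (intro allI impI monotone_opD[OF that(1)]) (auto simp: op_graph_def)
    then show "(x, u) \<in> op_graph A" using A by (auto simp: op_graph_def)
  qed
  then show "maximally_monotone A"
    using A by (auto simp: maximally_monotone_def)
qed

lemma maximally_monotoneD:
  assumes "maximally_monotone A" "\<And>y v. v \<in> A y \<Longrightarrow> 0 \<le> inner (x - y) (u - v)"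
  shows "u \<in> A x"
  using assms by (auto simp: maximally_monotone_iff)

lemma maximally_monotone_op_scale:
  fixes A :: "'a::real_inner operator"
  assumes "maximally_monotone A" "c > 0"
  shows "maximally_monotone (op_scale c A)"
proof -
  have "monotone_op (op_scale c A)"
    unfolding monotone_op_def op_graph_def op_scale_def
  proof clarify
    fix x u y v assume "u \<in> A x" "v \<in> A y"
    then have "0 \<le> inner (x - y) (u - v)"
      using assms(1) unfolding maximally_monotone_iff by (blast intro: monotone_opD)
    then show "0 \<le> inner (x - y) (c *\<^sub>R u - c *\<^sub>R v)"
      using assms(2) by (simp flip: scaleR_diff_right)
  qed
  moreover have "u \<in> op_scale c A x"
    if rel: "\<And>y v. v \<in> op_scale c A y \<Longrightarrow> 0 \<le> inner (x - y) (u - v)" for x u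
  proof -
    have "inverse c *\<^sub>R u \<in> A x"
    proof (rule maximally_monotoneD[OF assms(1)])
      fix y v assume "v \<in> A y"
      then have "0 \<le> inner (x - y) (u - c *\<^sub>R v)" by (intro rel) (auto simp: op_scale_def)
      also have "u - c *\<^sub>R v = c *\<^sub>R (inverse c *\<^sub>R u - v)"
        using assms(2) by (simp add: scaleR_diff_right)
      finally show "0 \<le> inner (x - y) (inverse c *\<^sub>R u - v)"
        using assms(2) by (simp add: zero_le_mult_iff)
    qed
    then show ?thesis
      using assms(2) by (auto simp: op_scale_def intro!: image_eqI[of _ _ "inverse c *\<^sub>R u"])
  qed
  ultimately show ?thesis by (simp add: maximally_monotone_iff)
qed

lemma maximally_monotone_shift:
  assumes "maximally_monotone A"
  shows "maximally_monotone (\<lambda>x. A (x + c))"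
  unfolding maximally_monotone_iff
proof (intro conjI allI impI)
  show "monotone_op (\<lambda>x. A (x + c))"
    unfolding monotone_op_def op_graph_def
  proof clarify
    fix x u y v assume "u \<in> A (x + c)" "v \<in> A (y + c)"
    with assms have "0 \<le> inner ((x + c) - (y + c)) (u - v)"
      unfolding maximally_monotone_iff by (blast intro: monotone_opD)
    then show "0 \<le> inner (x - y) (u - v)" by simp
  qed
next
  fix x u assume rel: "\<forall>y v. v \<in> A (y + c) \<longrightarrow> 0 \<le> inner (x - y) (u - v)"
  show "u \<in> A (x + c)"
  proof (rule maximally_monotoneD[OF assms])
    fix y v assume "v \<in> A y"
    then show "0 \<le> inner (x + c - y) (u - v)"
      using rel[rule_format, of v "y - c"] by (simp add: algebra_simps)
  qed
qed

text \<open>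
  The set \<open>E\<close> is the epigraph of the Fitzpatrick function
  \<open>F (x, u) = SUP (y, v) in graph A. <x, v> + <y, u> - <y, v>\<close>, which dominates \<open><x, u>\<close>.
  Optimality of a minimiser \<open>(x0, u0)\<close> of \<open>F + norm^2 / 2\<close> makes \<open>(-u0, -x0)\<close> monotonically
  related to \<open>A\<close>, and then forces \<open>u0 = -x0\<close>.
\<close>
lemma minty_zero:
  fixes A :: "'a::{real_inner, banach} operator"
  assumes A: "maximally_monotone A"
  shows "\<exists>x. - x \<in> A x"
proof -
  define E where "E = (\<Inter>(y, v)\<in>op_graph A.
    {p :: ('a \<times> 'a) \<times> real. inner (fst (fst p)) v + inner y (snd (fst p)) - inner y v \<le> snd p})"
  have E_iff: "((x, u), r) \<in> E \<longleftrightarrow> (\<forall>y v. v \<in> A y \<longrightarrow> inner x v + inner y u - inner y v \<le> r)" for x u r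
    by (auto simp: E_def op_graph_def)
  have mono: "monotone_op A" using A by (simp add: maximally_monotone_def)
  \<comment> \<open>If \<open>r\<close> were smaller, \<open>(x, u)\<close> would be monotonically
    related to the graph, hence in it; testing membership in \<open>E\<close> against
    \<open>(x, u)\<close> itself then contradicts this.\<close>
  have fitz_ge: "inner x u \<le> r" if "((x, u), r) \<in> E" for x u r
  proof (rule ccontr)
    assume r: "\<not> inner x u \<le> r"
    have "0 \<le> inner (x - y) (u - v)" if "v \<in> A y" for y v
      using r \<open>((x, u), r) \<in> E\<close> that unfolding E_iff by (force simp: inner_simps)
    then have "u \<in> A x" by (rule maximally_monotoneD[OF A])
    then show False using r \<open>((x, u), r) \<in> E\<close> unfolding E_iff by force
  qed
  have graph_in_E: "((x, u), inner x u) \<in> E" if "u \<in> A x" for x u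
    unfolding E_iff using monotone_opD[OF mono that] by (force simp: inner_simps)
  \<comment> \<open>Over an empty graph every pair would be vacuously related, and maximality would
    put \<open>(0, 0)\<close> into it.\<close>
  have "\<exists>x u. u \<in> A x"
    using maximally_monotoneD[OF A, of 0 0] by blast
  then have ne: "E \<noteq> {}" using graph_in_E by blast
  have conv: "convex E"
    unfolding E_def
  proof (intro convex_INT, clarify)
    fix y v :: 'a
    show "convex {p. inner (fst (fst p)) v + inner y (snd (fst p)) - inner y v \<le> snd p}" (is "convex ?S")
    proof (rule convexI)
      fix p q :: "('a \<times> 'a) \<times> real" and s t :: real
      assume p: "p \<in> ?S" and q: "q \<in> ?S" and s: "0 \<le> s" and t: "0 \<le> t" and st: "s + t = 1"
      have "s * (inner (fst (fst p)) v + inner y (snd (fst p)) - inner y v)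
          + t * (inner (fst (fst q)) v + inner y (snd (fst q)) - inner y v) \<le> s * snd p + t * snd q"
        using p q s t by (intro add_mono mult_left_mono) auto
      moreover have "inner y v = s * inner y v + t * inner y v"
        using st by (metis distrib_right mult_1)
      ultimately show "s *\<^sub>R p + t *\<^sub>R q \<in> ?S"
        by (simp add: inner_simps algebra_simps)
    qed
  qed
  have clos: "closed E"
    unfolding E_def by (intro closed_INT ballI, clarify, intro closed_Collect_le continuous_intros)
  have bdd: "0 \<le> r + (norm w)\<^sup>2 / 2" if "(w, r) \<in> E" for w r
  proof (cases w)
    case (Pair x u)
    have "(norm w)\<^sup>2 / 2 = (norm (x + u))\<^sup>2 / 2 - inner x u"
      unfolding Pair by (simp add: power2_norm_eq_inner inner_simps inner_commute field_simps)
    moreover have "inner x u \<le> r" using fitz_ge that Pair by simp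
    moreover have "0 \<le> (norm (x + u))\<^sup>2" by simp
    ultimately show ?thesis by linarith
  qed
  obtain w0 r0 where w0: "(w0, r0) \<in> E"
    and opt: "\<And>w r. (w, r) \<in> E \<Longrightarrow> r0 \<le> r + inner w0 (w - w0)"
    using quadratic_min_variational[OF conv clos ne bdd] by blast
  obtain x0 u0 where w0_eq: "w0 = (x0, u0)" by fastforce
  \<comment> \<open>Insert \<open><x0, u0> \<le> r0\<close> into the optimality inequality at
    \<open>((x, u), <x, u>)\<close> and add \<open><x0, u0>\<close> to both sides; the two sides
    then factor.\<close>
  have key: "(norm (x0 + u0))\<^sup>2 \<le> inner (- u0 - x) (- x0 - u)" if "u \<in> A x" for x u
    using opt[OF graph_in_E[OF that]] fitz_ge w0
    unfolding w0_eq by (force simp: power2_norm_eq_inner inner_simps inner_commute)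
  have "- x0 \<in> A (- u0)"
    by (rule maximally_monotoneD[OF A]) (use key in \<open>force intro: order_trans[OF zero_le_power2]\<close>)
  \<comment> \<open>At the pair \<open>(-u0, -x0)\<close> the right side of \<open>key\<close> is
    0.\<close>
  moreover from key[OF this] have "- u0 = x0"
    by (simp add: add_eq_0_iff)
  ultimately show ?thesis by auto
qed

lemma minty:
  fixes A :: "'a::{real_inner, banach} operator"
  assumes "maximally_monotone A"
  shows "\<exists>p. x - p \<in> A p"
proof -
  obtain q where "- q \<in> A (q + x)"
    using minty_zero[OF maximally_monotone_shift[OF assms, of x]] by blast
  then show ?thesis by (intro exI[of _ "q + x"]) simp
qed

section \<open>Resolvents as firmly nonexpansive maps\<close>

lemma firmly_nonexpansive_graph:
  fixes A :: "'a::real_inner operator"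
  assumes "monotone_op A" "x - p \<in> A p" "y - q \<in> A q"
  shows "(norm (p - q))\<^sup>2 \<le> inner (p - q) (x - y)"
  using monotone_opD[OF assms] by (simp add: power2_norm_eq_inner inner_simps algebra_simps)

text \<open>Minty's theorem gives existence, and the firm inequality for two solutions at the same
  point gives uniqueness. Later arguments use this inclusion in place of
  \<open>the_elem\<close>.\<close>

lemma resolvent_eq_iff:
  fixes A :: "'a::{real_inner, banach} operator"
  assumes "maximally_monotone A"
  shows "resolvent A x = p \<longleftrightarrow> x - p \<in> A p"
proof -
  have mem: "q \<in> op_inverse (op_add op_id A) x \<longleftrightarrow> x - q \<in> A q" for q
    by (auto simp: op_inverse_def op_add_def op_id_def set_plus_def algebra_simps)
      (metis add.commute diff_add_cancel)
  obtain p0 where p0: "x - p0 \<in> A p0" using minty[OF assms] by blast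
  have "q = p0" if "x - q \<in> A q" for q
    using firmly_nonexpansive_graph[OF _ that p0] assms by (simp add: maximally_monotone_def)
  then have "op_inverse (op_add op_id A) x = {p0}"
    using p0 mem by blast
  then have "resolvent A x = p0" by (simp add: resolvent_def)
  then show ?thesis using p0 \<open>\<And>q. x - q \<in> A q \<Longrightarrow> q = p0\<close> by blast
qed

lemma resolvent_mem:
  fixes A :: "'a::{real_inner, banach} operator"
  assumes "maximally_monotone A"
  shows "x - resolvent A x \<in> A (resolvent A x)"
  using resolvent_eq_iff[OF assms] by blast

lemma resolvent_firmly_nonexpansive:
  fixes A :: "'a::{real_inner, banach} operator"
  assumes "maximally_monotone A"
  shows "(norm (resolvent A x - resolvent A y))\<^sup>2 \<le> inner (resolvent A x - resolvent A y) (x - y)"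
  using assms by (intro firmly_nonexpansive_graph[of A] resolvent_mem)
    (simp_all add: maximally_monotone_iff)

lemma resolvent_nonexpansive:
  fixes A :: "'a::{real_inner, banach} operator"
  assumes "maximally_monotone A"
  shows "norm (resolvent A x - resolvent A y) \<le> norm (x - y)"
proof -
  have "(norm (resolvent A x - resolvent A y))\<^sup>2 \<le> norm (resolvent A x - resolvent A y) * norm (x - y)"
    using resolvent_firmly_nonexpansive[OF assms] norm_cauchy_schwarz order_trans by blast
  then show ?thesis by (cases "resolvent A x = resolvent A y") (auto simp: power2_eq_square)
qed

text \<open>With \<open>d\<close> the difference of resolvents and \<open>h\<close> that of
  arguments, the squared norm of \<open>2 d - h\<close> exceeds that of \<open>h\<close> by 4 times
  \<open>norm d^2 - <d, h>\<close>, which firm nonexpansiveness makes nonpositive.\<close>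

lemma reflected_resolvent_nonexpansive:
  fixes A :: "'a::{real_inner, banach} operator"
  assumes "maximally_monotone A"
  shows "norm (reflected_resolvent A x - reflected_resolvent A y) \<le> norm (x - y)"
proof (rule power2_le_imp_le)
  have "reflected_resolvent A x - reflected_resolvent A y
      = 2 *\<^sub>R (resolvent A x - resolvent A y) - (x - y)"
    by (simp add: reflected_resolvent_def algebra_simps)
  moreover have "(norm (2 *\<^sub>R d - h))\<^sup>2 = (norm h)\<^sup>2 + 4 * ((norm d)\<^sup>2 - inner d h)" for d h :: 'a
    by (simp add: power2_norm_eq_inner inner_diff_left inner_diff_right inner_commute)
  ultimately show "(norm (reflected_resolvent A x - reflected_resolvent A y))\<^sup>2 \<le> (norm (x - y))\<^sup>2"
    using resolvent_firmly_nonexpansive[OF assms, of x y] by simp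
qed simp

section \<open>Nonexpansive maps\<close>

text \<open>The obtuse-angle condition yields a Pythagorean inequality, from which both the
  minimality of \<open>p\<close> and its uniqueness follow, as the \<open>THE\<close>
  demands.\<close>

lemma metric_proj_eqI:
  fixes C :: "'a::real_inner set"
  assumes "p \<in> C" "\<And>q. q \<in> C \<Longrightarrow> inner (x - p) (q - p) \<le> 0"
  shows "metric_proj C x = p"
  unfolding metric_proj_def
proof (rule the_equality)
  have le: "(dist x p)\<^sup>2 + (dist p q)\<^sup>2 \<le> (dist x q)\<^sup>2" if "q \<in> C" for q
  proof -
    have "(norm (x - q))\<^sup>2 = (norm (x - p))\<^sup>2 + (norm (p - q))\<^sup>2 - 2 * inner (x - p) (q - p)"
      by (simp add: power2_norm_eq_inner inner_simps inner_commute)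
    then show ?thesis using assms(2)[OF that] by (simp add: dist_norm)
  qed
  have "dist x p \<le> dist x q" if "q \<in> C" for q
    by (rule power2_le_imp_le) (use le[OF that] zero_le_power2[of "dist p q"] in linarith, simp)
  then show "p \<in> C \<and> (\<forall>q\<in>C. dist x p \<le> dist x q)" using assms(1) by blast
  fix q assume q: "q \<in> C \<and> (\<forall>q'\<in>C. dist x q \<le> dist x q')"
  then have "(dist x q)\<^sup>2 \<le> (dist x p)\<^sup>2" using assms(1) by (intro power_mono) auto
  then have "(dist p q)\<^sup>2 \<le> 0" using le[of q] q by linarith
  then show "q = p" by simp
qed

lemma nonexpansive_id_minus_monotone:
  fixes T :: "'a::real_inner \<Rightarrow> 'a"
  assumes "norm (T x - T y) \<le> norm (x - y)"
  shows "0 \<le> inner ((x - T x) - (y - T y)) (x - y)"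
proof -
  have "inner (T x - T y) (x - y) \<le> norm (T x - T y) * norm (x - y)"
    by (rule norm_cauchy_schwarz)
  also have "\<dots> \<le> inner (x - y) (x - y)"
    using mult_right_mono[OF assms, of "norm (x - y)"]
    by (simp add: power2_eq_square flip: power2_norm_eq_inner)
  finally show ?thesis by (simp add: inner_simps)
qed

text \<open>
  Browder's approximating curve: \<open>V k\<close> solves \<open>a v + (v - T v) = 0\<close> with \<open>a = 1 / (k + 1)\<close>.
  Monotonicity of \<open>I - T\<close> makes \<open>norm (V k)\<close> increasing and bounds \<open>norm (V j - V k)^2\<close> by the
  increment of \<open>norm^2\<close>.
\<close>
lemma browder_curve:
  fixes T :: "'a::{real_inner, banach} \<Rightarrow> 'a"
  assumes T: "\<And>x y. norm (T x - T y) \<le> norm (x - y)" and ne: "Fix T \<noteq> {}"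
  obtains V v where "\<And>k. T (V k) - V k = inverse (real (Suc k)) *\<^sub>R V k"
    and "V \<longlonglongrightarrow> v" and "v \<in> Fix T" and "\<And>q. q \<in> Fix T \<Longrightarrow> inner v (v - q) \<le> 0"
proof -
  define a where "a k = inverse (real (Suc k))" for k
  have a_pos: "0 < a k" for k by (simp add: a_def)
  have "\<exists>v. T v - v = a k *\<^sub>R v" for k
  proof -
    \<comment> \<open>The equation \<open>(1 + a) v = T v\<close> reads \<open>v = c T v\<close>,
      the fixed point equation of a contraction.\<close>
    define c where "c = inverse (1 + a k)"
    have c: "0 \<le> c" "c < 1" using a_pos[of k] by (auto simp: c_def field_simps)
    have "\<exists>!v. c *\<^sub>R T v = v"
      by (rule banach_fix_type[OF c])
        (use c(1) in \<open>auto simp: dist_norm simp flip: scaleR_diff_right intro!: mult_left_mono T\<close>)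
    then obtain v where "c *\<^sub>R T v = v" by blast
    then have "(1 + a k) *\<^sub>R v = T v"
      using a_pos[of k] by (auto simp: c_def dest: arg_cong[of _ _ "\<lambda>v. (1 + a k) *\<^sub>R v"])
    then show ?thesis by (auto simp: algebra_simps intro!: exI[of _ v])
  qed
  then obtain V where V: "\<And>k. T (V k) - V k = a k *\<^sub>R V k" by metis
  have V': "V k - T (V k) = - (a k *\<^sub>R V k)" for k using V[of k] by (simp add: algebra_simps)
  have var: "inner (V k) (V k - q) \<le> 0" if "q \<in> Fix T" for k q
  proof -
    have "0 \<le> inner ((V k - T (V k)) - (q - T q)) (V k - q)"
      by (rule nonexpansive_id_minus_monotone[OF T])
    then have "0 \<le> - (a k * inner (V k) (V k - q))" using that V'[of k] by (simp add: Fix_def)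
    then show ?thesis using a_pos[of k] by (simp add: mult_le_0_iff)
  qed
  have gap: "(norm (V j - V k))\<^sup>2 \<le> (norm (V k))\<^sup>2 - (norm (V j))\<^sup>2" if "j \<le> k" for j k
  proof -
    have ajk: "a k \<le> a j" using that by (simp add: a_def field_simps)
    have "0 \<le> inner ((V j - T (V j)) - (V k - T (V k))) (V j - V k)"
      by (rule nonexpansive_id_minus_monotone[OF T])
    then have "inner (a j *\<^sub>R V j - a k *\<^sub>R V k) (V j - V k) \<le> 0"
      unfolding V' by (simp add: inner_simps)
    \<comment> \<open>Polarisation separates the distance from the increment of the squared norm;
      since \<open>0 \<le> a j - a k \<le> a j + a k\<close>, the common weight can then be
      cancelled.\<close>
    moreover have "2 * inner (a j *\<^sub>R V j - a k *\<^sub>R V k) (V j - V k)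
        = (a j + a k) * (norm (V j - V k))\<^sup>2 - (a j - a k) * ((norm (V k))\<^sup>2 - (norm (V j))\<^sup>2)"
      by (simp add: power2_norm_eq_inner inner_simps inner_commute algebra_simps)
    ultimately have *: "(a j + a k) * (norm (V j - V k))\<^sup>2
        \<le> (a j - a k) * ((norm (V k))\<^sup>2 - (norm (V j))\<^sup>2)"
      by linarith
    have "0 \<le> (a j + a k) * (norm (V j - V k))\<^sup>2"
      using a_pos[of j] a_pos[of k] by simp
    with * have **: "0 \<le> (a j - a k) * ((norm (V k))\<^sup>2 - (norm (V j))\<^sup>2)" by linarith
    show ?thesis
    proof (cases "a j = a k")
      case True
      then show ?thesis using * a_pos[of k] that by (simp add: mult_le_0_iff a_def)
    next
      case False
      with ajk ** have D: "0 \<le> (norm (V k))\<^sup>2 - (norm (V j))\<^sup>2"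
        by (simp add: zero_le_mult_iff)
      have "(a j - a k) * ((norm (V k))\<^sup>2 - (norm (V j))\<^sup>2)
          \<le> (a j + a k) * ((norm (V k))\<^sup>2 - (norm (V j))\<^sup>2)"
        using D a_pos[of k] by (intro mult_right_mono) auto
      with * show ?thesis
        using a_pos[of j] a_pos[of k] by (meson add_pos_pos mult_le_cancel_left_pos order_trans)
    qed
  qed
  obtain q0 where q0: "q0 \<in> Fix T" using ne by blast
  have "norm (V k) \<le> norm q0" for k
  proof -
    have "norm (V k) * norm (V k) \<le> inner (V k) q0"
      using var[OF q0, of k] by (simp add: inner_diff_right power2_norm_eq_inner flip: power2_eq_square)
    also have "\<dots> \<le> norm (V k) * norm q0" by (rule norm_cauchy_schwarz)
    finally show ?thesis by (cases "V k = 0") auto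
  qed
  then have "\<forall>k. (norm (V k))\<^sup>2 \<le> (norm q0)\<^sup>2" by (simp add: power_mono)
  moreover have "incseq (\<lambda>k. (norm (V k))\<^sup>2)"
    by (rule incseq_SucI) (use gap[of n "Suc n" for n] order_trans[OF zero_le_power2] in fastforce)
  ultimately obtain L where "(\<lambda>k. (norm (V k))\<^sup>2) \<longlonglongrightarrow> L"
    using incseq_convergent by metis
  then have cau: "Cauchy (\<lambda>k. (norm (V k))\<^sup>2)" by (rule LIMSEQ_imp_Cauchy)
  have "Cauchy V"
  proof (rule metric_CauchyI)
    fix \<epsilon> :: real assume \<epsilon>: "\<epsilon> > 0"
    then obtain N where N: "\<And>i j. i \<ge> N \<Longrightarrow> j \<ge> N \<Longrightarrow> dist ((norm (V i))\<^sup>2) ((norm (V j))\<^sup>2) < \<epsilon>\<^sup>2"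
      using metric_CauchyD[OF cau, of "\<epsilon>\<^sup>2"] by auto
    have "dist (V i) (V j) < \<epsilon>" if "i \<ge> N" "j \<ge> N" for i j
    proof (rule power2_less_imp_less)
      have "(dist (V i) (V j))\<^sup>2 \<le> dist ((norm (V i))\<^sup>2) ((norm (V j))\<^sup>2)"
        using gap[of i j] gap[of j i] by (cases "i \<le> j") (auto simp: dist_norm norm_minus_commute)
      then show "(dist (V i) (V j))\<^sup>2 < \<epsilon>\<^sup>2" using N[OF that] by linarith
    qed (use \<epsilon> in simp)
    then show "\<exists>M. \<forall>i\<ge>M. \<forall>j\<ge>M. dist (V i) (V j) < \<epsilon>" by blast
  qed
  then obtain v where lim: "V \<longlonglongrightarrow> v" using Cauchy_convergent_iff convergent_def by blast
  have "continuous_on UNIV T"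
    by (rule continuous_on_iff[THEN iffD2]) (use T in \<open>auto simp: dist_norm intro: le_less_trans\<close>)
  then have "(\<lambda>k. T (V k)) \<longlonglongrightarrow> T v"
    using lim by (rule continuous_on_tendsto_compose) auto
  then have "(\<lambda>k. T (V k) - V k) \<longlonglongrightarrow> T v - v" by (intro tendsto_intros lim)
  moreover have "(\<lambda>k. T (V k) - V k) \<longlonglongrightarrow> 0 *\<^sub>R v"
    unfolding V a_def by (intro tendsto_intros lim LIMSEQ_inverse_real_of_nat)
  ultimately have "T v - v = 0 *\<^sub>R v" by (rule LIMSEQ_unique)
  then have "v \<in> Fix T" by (simp add: Fix_def)
  \<comment> \<open>The limit of \<open>var\<close> is the obtuse-angle condition for projecting 0
    onto \<open>Fix T\<close>.\<close>
  moreover have "inner v (v - q) \<le> 0" if "q \<in> Fix T" for q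
    by (rule tendsto_upperbound[where f = "\<lambda>k. inner (V k) (V k - q)"])
      (use var[OF that] in \<open>auto intro!: tendsto_intros lim\<close>)
  ultimately show thesis using that[of V v] V lim by (simp add: a_def)
qed

text \<open>The subtracted term of the convex-combination identity is kept: it later forces the
  residual \<open>T w - w\<close> to vanish.\<close>

lemma convex_combination_fixed_point_le:
  fixes T :: "'a::real_inner \<Rightarrow> 'a"
  assumes "norm (T w - p) \<le> norm (w - p)" "0 \<le> t"
  shows "(norm (w + t *\<^sub>R (T w - w) - p))\<^sup>2 \<le> (norm (w - p))\<^sup>2 - t * (1 - t) * (norm (T w - w))\<^sup>2"
proof -
  have "(norm (w + t *\<^sub>R (T w - w) - p))\<^sup>2
      = (1 - t) * (norm (w - p))\<^sup>2 + t * (norm (T w - p))\<^sup>2 - t * (1 - t) * (norm (T w - w))\<^sup>2"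
    by (simp add: power2_norm_eq_inner inner_simps inner_commute algebra_simps)
  moreover have "t * (norm (T w - p))\<^sup>2 \<le> t * (norm (w - p))\<^sup>2"
    using assms by (intro mult_left_mono power_mono) auto
  ultimately show ?thesis by (simp add: algebra_simps)
qed

lemma convex_combination_nonexpansive:
  fixes T :: "'a::real_normed_vector \<Rightarrow> 'a"
  assumes "norm (T x - T y) \<le> norm (x - y)" "0 \<le> t" "t \<le> 1"
  shows "norm ((x + t *\<^sub>R (T x - x)) - (y + t *\<^sub>R (T y - y))) \<le> norm (x - y)"
proof -
  have "(x + t *\<^sub>R (T x - x)) - (y + t *\<^sub>R (T y - y)) = (1 - t) *\<^sub>R (x - y) + t *\<^sub>R (T x - T y)"
    by (simp add: algebra_simps)
  also have "norm \<dots> \<le> (1 - t) * norm (x - y) + t * norm (T x - T y)"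
    using assms by (intro norm_triangle_le) simp
  also have "\<dots> \<le> (1 - t) * norm (x - y) + t * norm (x - y)"
    using assms by (intro add_left_mono mult_left_mono) auto
  finally show ?thesis by (simp add: algebra_simps)
qed

section \<open>The anchored iteration\<close>

text \<open>Unrolling from a late index \<open>N\<close> leaves three parts: a weighted average of
  the \<beta>-terms, the initial value damped by a product of factors 1 - \<alpha>, and a tail of
  \<open>d\<close>. Since 1 - \<alpha> is at most exp (-\<alpha>), divergence of the sum kills the
  damped part.\<close>

lemma recursive_ineq_tendsto_zero:
  fixes s \<alpha> \<beta> d :: "nat \<Rightarrow> real"
  assumes s: "\<And>n. 0 \<le> s n" and \<alpha>: "\<And>n. 0 \<le> \<alpha> n" "\<And>n. \<alpha> n \<le> 1"
    and div: "filterlim (\<lambda>n. \<Sum>k<n. \<alpha> k) at_top sequentially"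
    and \<beta>: "\<And>\<epsilon>. 0 < \<epsilon> \<Longrightarrow> eventually (\<lambda>n. \<beta> n \<le> \<epsilon>) sequentially"
    and d: "\<And>n. 0 \<le> d n" "summable d"
    and step: "\<And>n. s (Suc n) \<le> (1 - \<alpha> n) * s n + \<alpha> n * \<beta> n + d n"
  shows "s \<longlonglongrightarrow> 0"
proof (rule LIMSEQ_I)
  fix \<epsilon> :: real assume "0 < \<epsilon>"
  then have \<epsilon>: "0 < \<epsilon> / 3" by simp
  obtain N1 where N1: "\<And>n. n \<ge> N1 \<Longrightarrow> \<beta> n \<le> \<epsilon> / 3"
    using \<beta>[OF \<epsilon>] by (auto simp: eventually_sequentially)
  obtain N2 where N2: "\<And>n. n \<ge> N2 \<Longrightarrow> norm (\<Sum>i. d (i + n)) < \<epsilon> / 3"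
    using suminf_exist_split[OF \<epsilon> d(2)] by blast
  define N where "N = max N1 N2"
  let ?E = "\<lambda>m. exp (- (\<Sum>k<m. \<alpha> (k + N))) * s N"
  have bound: "s (m + N) \<le> \<epsilon> / 3 + ?E m + (\<Sum>k<m. d (k + N))" for m
  proof (induction m)
    case 0
    then show ?case using \<epsilon> by simp
  next
    case (Suc m)
    let ?a = "\<alpha> (m + N)" and ?D = "\<Sum>k<m. d (k + N)"
    have "s (Suc m + N) \<le> (1 - ?a) * s (m + N) + ?a * \<beta> (m + N) + d (m + N)"
      using step[of "m + N"] by simp
    also have "\<dots> \<le> (1 - ?a) * (\<epsilon> / 3 + ?E m + ?D) + ?a * (\<epsilon> / 3) + d (m + N)"
      using Suc \<alpha>[of "m + N"] N1[of "m + N"]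
      by (intro add_mono mult_left_mono) (auto simp: N_def)
    also have "\<dots> = \<epsilon> / 3 + (1 - ?a) * ?E m + (1 - ?a) * ?D + d (m + N)"
      by (simp add: algebra_simps)
    also have "\<dots> \<le> \<epsilon> / 3 + exp (- ?a) * ?E m + 1 * ?D + d (m + N)"
      using \<alpha>[of "m + N"] s[of N] exp_ge_add_one_self[of "- ?a"]
      by (intro add_mono mult_right_mono sum_nonneg d(1)) auto
    also have "exp (- ?a) * ?E m = ?E (Suc m)"
      by (simp add: exp_add[symmetric] mult.assoc[symmetric])
    finally show ?case by simp
  qed
  have "filterlim (\<lambda>m. - (\<Sum>k<N. \<alpha> k) + (\<Sum>k<m + N. \<alpha> k)) at_top sequentially"
    by (rule filterlim_tendsto_add_at_top[OF tendsto_const])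
      (rule filterlim_compose[OF div filterlim_add_const_nat_at_top])
  moreover have "- (\<Sum>k<N. \<alpha> k) + (\<Sum>k<m + N. \<alpha> k) = (\<Sum>k<m. \<alpha> (k + N))" for m
    by (induction m) auto
  ultimately have "filterlim (\<lambda>m. \<Sum>k<m. \<alpha> (k + N)) at_top sequentially" by simp
  then have "(\<lambda>m. exp (- (\<Sum>k<m. \<alpha> (k + N)))) \<longlonglongrightarrow> 0"
    by (intro filterlim_compose[OF exp_at_bot] filterlim_compose[OF filterlim_uminus_at_bot_at_top])
  then have "?E \<longlonglongrightarrow> 0" by (rule tendsto_mult_left_zero)
  then have "eventually (\<lambda>m. ?E m < \<epsilon> / 3) sequentially"
    using \<epsilon> by (rule order_tendstoD(2))
  then obtain M where M: "\<And>m. m \<ge> M \<Longrightarrow> ?E m < \<epsilon> / 3"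
    unfolding eventually_sequentially by blast
  have tail: "(\<Sum>k<m. d (k + N)) < \<epsilon> / 3" for m
  proof -
    have "(\<Sum>k<m. d (k + N)) \<le> (\<Sum>k. d (k + N))"
      using d by (intro sum_le_suminf) (auto simp: summable_iff_shift)
    also have "\<dots> \<le> norm (\<Sum>k. d (k + N))" by simp
    also have "\<dots> < \<epsilon> / 3" by (rule N2) (simp add: N_def)
    finally show ?thesis .
  qed
  show "\<exists>n0. \<forall>n\<ge>n0. norm (s n - 0) < \<epsilon>"
  proof (intro exI[of _ "M + N"] allI impI)
    fix n assume "n \<ge> M + N"
    then have "n = (n - N) + N" "n - N \<ge> M" by auto
    then have "s n < \<epsilon>" using bound[of "n - N"] M[of "n - N"] tail[of "n - N"] by simp
    then show "norm (s n - 0) < \<epsilon>" using s by simp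
  qed
qed

text \<open>The scheme for an abstract nonexpansive \<open>T\<close>, indexed from 0, with
  \<open>l\<close> standing for \<theta>/2. The bounds \<open>lo\<close> and \<open>up\<close> keep
  \<open>l (1 - l)\<close> away from 0.\<close>

locale anchored_iteration =
  fixes T :: "'a::{real_inner, banach} \<Rightarrow> 'a"
    and X w :: "nat \<Rightarrow> 'a" and e l :: "nat \<Rightarrow> real" and lo up :: real
  assumes T: "\<And>x y. norm (T x - T y) \<le> norm (x - y)"
    and Fix_ne: "Fix T \<noteq> {}"
    and w_eq: "\<And>n. w n = e n *\<^sub>R X n"
    and X_Suc: "\<And>n. X (Suc n) = T (w n + l n *\<^sub>R (T (w n) - w n))"
    and e: "\<And>n. 0 < e n" "\<And>n. e n < 1"
    and e_lim: "e \<longlonglongrightarrow> 1"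
    and e_div: "filterlim (\<lambda>n. \<Sum>k<n. 1 - e k) at_top sequentially"
    and e_sum: "summable (\<lambda>n. \<bar>e (Suc n) - e n\<bar>)"
    and lo: "0 < lo" and up: "up < 1"
    and l: "\<And>n. lo \<le> l n" "\<And>n. l n \<le> up"
    and l_sum: "summable (\<lambda>n. \<bar>l (Suc n) - l n\<bar>)"
begin

lemma l_bounds: "0 \<le> l n" "l n \<le> 1"
  using lo up l[of n] by linarith+

lemma fixed_point_le:
  assumes "p \<in> Fix T"
  shows "norm (T x - p) \<le> norm (x - p)"
  using T[of x p] assms by (simp add: Fix_def)

lemma X_Suc_le:
  assumes "p \<in> Fix T"
  shows "(norm (X (Suc n) - p))\<^sup>2
    \<le> (norm (w n - p))\<^sup>2 - l n * (1 - l n) * (norm (T (w n) - w n))\<^sup>2"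
proof -
  have "(norm (X (Suc n) - p))\<^sup>2 \<le> (norm (w n + l n *\<^sub>R (T (w n) - w n) - p))\<^sup>2"
    unfolding X_Suc by (intro power_mono fixed_point_le assms) simp
  also have "\<dots> \<le> (norm (w n - p))\<^sup>2 - l n * (1 - l n) * (norm (T (w n) - w n))\<^sup>2"
    by (intro convex_combination_fixed_point_le fixed_point_le assms l_bounds)
  finally show ?thesis .
qed

lemma X_Suc_norm_le:
  assumes "p \<in> Fix T"
  shows "norm (X (Suc n) - p) \<le> norm (w n - p)"
proof (rule power2_le_imp_le)
  have "0 \<le> l n * (1 - l n) * (norm (T (w n) - w n))\<^sup>2" using l_bounds[of n] by simp
  then show "(norm (X (Suc n) - p))\<^sup>2 \<le> (norm (w n - p))\<^sup>2" using X_Suc_le[OF assms, of n] by linarith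
qed simp

text \<open>\<open>w n - p\<close> is a convex combination of \<open>X n - p\<close> and
  \<open>- p\<close>, so a ball around \<open>p\<close> that contains 0 and the starting point is
  never left.\<close>

lemma bounded_iterates:
  obtains M where "\<And>n. norm (X n) \<le> M" "\<And>n. norm (w n) \<le> M" "\<And>n. norm (T (w n) - w n) \<le> M"
proof -
  obtain p where p: "p \<in> Fix T" using Fix_ne by blast
  define K where "K = max (norm (X 0 - p)) (norm p)"
  have w_le: "norm (w n - p) \<le> K" if "norm (X n - p) \<le> K" for n
  proof -
    have "w n - p = e n *\<^sub>R (X n - p) + (1 - e n) *\<^sub>R (- p)"
      by (simp add: w_eq algebra_simps)
    also have "norm \<dots> \<le> e n * norm (X n - p) + (1 - e n) * norm p"
      using e[of n] by (intro norm_triangle_le) simp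
    also have "\<dots> \<le> e n * K + (1 - e n) * K"
      using that e[of n] by (intro add_mono mult_left_mono) (auto simp: K_def)
    finally show ?thesis by (simp add: algebra_simps)
  qed
  have X_le: "norm (X n - p) \<le> K" for n
  proof (induction n)
    case 0
    show ?case by (simp add: K_def)
  next
    case (Suc n)
    then show ?case using X_Suc_norm_le[OF p, of n] w_le by (meson order_trans)
  qed
  show thesis
  proof (rule that[of "2 * K + norm p"])
    fix n
    have K: "0 \<le> K" by (simp add: K_def max.coboundedI2)
    show "norm (X n) \<le> 2 * K + norm p"
      using X_le[of n] K norm_triangle_sub[of "X n" p] by linarith
    show "norm (w n) \<le> 2 * K + norm p"
      using w_le[OF X_le, of n] K norm_triangle_sub[of "w n" p] by linarith
    have "norm (T (w n) - w n) \<le> norm (T (w n) - p) + norm (w n - p)"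
      using norm_triangle_ineq4[of "T (w n) - p" "w n - p"] by simp
    then show "norm (T (w n) - w n) \<le> 2 * K + norm p"
      using fixed_point_le[OF p, of "w n"] w_le[OF X_le, of n] norm_ge_zero[of p] by linarith
  qed
qed

text \<open>Consecutive steps contract by the factor \<open>e (Suc n)\<close>, up to the variations
  of \<open>e\<close> and \<open>l\<close>, which are summable; the recursion lemma applies with
  \<beta> = 0.\<close>

lemma asymptotic_regularity: "(\<lambda>n. norm (X (Suc n) - X n)) \<longlonglongrightarrow> 0"
proof -
  obtain M where M: "\<And>n. norm (X n) \<le> M" "\<And>n. norm (w n) \<le> M" "\<And>n. norm (T (w n) - w n) \<le> M"
    using bounded_iterates by blast
  have M0: "0 \<le> M" using M(1)[of 0] norm_ge_zero[of "X 0"] by linarith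
  let ?d = "\<lambda>n. \<bar>e (Suc n) - e n\<bar> * M + \<bar>l (Suc n) - l n\<bar> * M"
  have step: "norm (X (Suc (Suc n)) - X (Suc n)) \<le> e (Suc n) * norm (X (Suc n) - X n) + ?d n" for n
  proof -
    let ?S = "\<lambda>t x. x + t *\<^sub>R (T x - x)"
    have "norm (X (Suc (Suc n)) - X (Suc n)) \<le> norm (?S (l (Suc n)) (w (Suc n)) - ?S (l n) (w n))"
      unfolding X_Suc by (rule T)
    also have "?S (l (Suc n)) (w (Suc n)) - ?S (l n) (w n)
        = (?S (l (Suc n)) (w (Suc n)) - ?S (l (Suc n)) (w n)) + (l (Suc n) - l n) *\<^sub>R (T (w n) - w n)"
      by (simp add: algebra_simps)
    also have "norm \<dots> \<le> norm (w (Suc n) - w n) + \<bar>l (Suc n) - l n\<bar> * M"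
      using M(3)[of n]
      by (intro order_trans[OF norm_triangle_ineq] add_mono convex_combination_nonexpansive T l_bounds)
        (simp add: mult_left_mono)
    finally have 1: "norm (X (Suc (Suc n)) - X (Suc n)) \<le> norm (w (Suc n) - w n) + \<bar>l (Suc n) - l n\<bar> * M" .
    have "w (Suc n) - w n = e (Suc n) *\<^sub>R (X (Suc n) - X n) + (e (Suc n) - e n) *\<^sub>R X n"
      by (simp add: w_eq algebra_simps)
    also have "norm \<dots> \<le> e (Suc n) * norm (X (Suc n) - X n) + \<bar>e (Suc n) - e n\<bar> * M"
      using e(1)[of "Suc n"] M(1)[of n]
      by (intro order_trans[OF norm_triangle_ineq] add_mono) (auto simp: mult_left_mono)
    finally show ?thesis using 1 by linarith
  qed
  show ?thesis
  proof (rule recursive_ineq_tendsto_zero[where \<alpha> = "\<lambda>n. 1 - e (Suc n)" and \<beta> = "\<lambda>_. 0" and d = ?d])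
    \<comment> \<open>The contraction factor carries the index \<open>Suc n\<close>, so the first
      summand has to be dropped from the divergent series.\<close>
    have "filterlim (\<lambda>n. - (1 - e 0) + (\<Sum>k<Suc n. 1 - e k)) at_top sequentially"
      by (rule filterlim_tendsto_add_at_top[OF tendsto_const])
        (rule filterlim_compose[OF e_div filterlim_Suc])
    then show "filterlim (\<lambda>n. \<Sum>k<n. 1 - e (Suc k)) at_top sequentially"
      unfolding sum.lessThan_Suc_shift by simp
    show "summable ?d" by (intro summable_add summable_mult2 e_sum l_sum)
    show "0 \<le> ?d n" for n using M0 by simp
  qed (use e step in \<open>auto intro: less_imp_le\<close>)
qed

lemma w_minus_X: "(\<lambda>n. w n - X n) \<longlonglongrightarrow> 0"
proof -
  obtain M where M: "\<And>n. norm (X n) \<le> M" "\<And>n. norm (w n) \<le> M" "\<And>n. norm (T (w n) - w n) \<le> M"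
    using bounded_iterates by blast
  have "(\<lambda>n. (1 - e n) * M) \<longlonglongrightarrow> 0"
    using tendsto_mult_right[OF tendsto_diff[OF tendsto_const[of 1] e_lim], of M] by simp
  moreover have "norm (w n - X n) \<le> (1 - e n) * M" for n
  proof -
    have "w n - X n = - ((1 - e n) *\<^sub>R X n)" by (simp add: w_eq algebra_simps)
    then show ?thesis using e[of n] M(1)[of n] by (simp add: mult_left_mono)
  qed
  ultimately show ?thesis by (rule_tac Lim_null_comparison) auto
qed

lemma residual_tendsto_zero: "(\<lambda>n. T (w n) - w n) \<longlonglongrightarrow> 0"
proof -
  obtain M where M: "\<And>n. norm (X n) \<le> M" "\<And>n. norm (w n) \<le> M" "\<And>n. norm (T (w n) - w n) \<le> M"
    using bounded_iterates by blast
  obtain p where p: "p \<in> Fix T" using Fix_ne by blast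
  \<comment> \<open>A uniform lower bound for \<open>l n * (1 - l n)\<close>, the coefficient of the
    squared residual in \<open>X_Suc_le\<close>.\<close>
  define c where "c = lo * (1 - up)"
  have c: "0 < c" using lo up by (simp add: c_def)
  let ?g = "\<lambda>n. (norm (w n - X n) + norm (X (Suc n) - X n)) * (2 * (M + norm p)) / c"
  have lim: "?g \<longlonglongrightarrow> 0"
    using tendsto_mult_left_zero[OF tendsto_add_zero[OF tendsto_norm_zero[OF w_minus_X] asymptotic_regularity]]
    by (intro tendsto_divide_zero)
  have le: "(norm (T (w n) - w n))\<^sup>2 \<le> ?g n" for n
  proof -
    let ?r = "norm (w n - p)" and ?s = "norm (X (Suc n) - p)"
    have "c * (norm (T (w n) - w n))\<^sup>2 \<le> l n * (1 - l n) * (norm (T (w n) - w n))\<^sup>2"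
      unfolding c_def using l[of n] l_bounds[of n] lo up by (intro mult_right_mono mult_mono) auto
    also have "\<dots> \<le> ?r\<^sup>2 - ?s\<^sup>2" using X_Suc_le[OF p, of n] by linarith
    \<comment> \<open>The first factor is at most the distance from \<open>w n\<close> to
      \<open>X (Suc n)\<close>, which tends to 0; the second is bounded.\<close>
    also have "\<dots> = (?r - ?s) * (?r + ?s)" by (simp add: power2_eq_square algebra_simps)
    also have "\<dots> \<le> (norm (w n - X n) + norm (X (Suc n) - X n)) * (2 * (M + norm p))"
    proof (rule mult_mono)
      have "?r - ?s \<le> norm (w n - X (Suc n))"
        using norm_triangle_ineq2[of "w n - p" "X (Suc n) - p"] by simp
      also have "\<dots> \<le> norm (w n - X n) + norm (X (Suc n) - X n)"
        using norm_triangle_ineq4[of "w n - X n" "X (Suc n) - X n"] by simp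
      finally show "?r - ?s \<le> norm (w n - X n) + norm (X (Suc n) - X n)" .
      have "?r \<le> M + norm p" using norm_triangle_ineq4[of "w n" p] M(2)[of n] by linarith
      moreover have "?s \<le> M + norm p"
        using norm_triangle_ineq4[of "X (Suc n)" p] M(1)[of "Suc n"] by linarith
      ultimately show "?r + ?s \<le> 2 * (M + norm p)" by simp
    qed auto
    finally show ?thesis using c by (simp add: pos_le_divide_eq mult.commute)
  qed
  have "(\<lambda>n. (norm (T (w n) - w n))\<^sup>2) \<longlonglongrightarrow> 0"
    by (rule Lim_null_comparison[OF _ lim]) (use le in simp)
  then have "(\<lambda>n. norm (T (w n) - w n)) \<longlonglongrightarrow> 0"
    using tendsto_real_sqrt by fastforce
  then show ?thesis by (rule tendsto_norm_zero_cancel)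
qed

section \<open>Strong convergence to the fixed point of least norm\<close>

lemma converges:
  shows "X \<longlonglongrightarrow> metric_proj (Fix T) 0"
    and "w \<longlonglongrightarrow> metric_proj (Fix T) 0"
    and "metric_proj (Fix T) 0 \<in> Fix T"
proof -
  obtain V v where V: "\<And>k. T (V k) - V k = inverse (real (Suc k)) *\<^sub>R V k"
    and Vlim: "V \<longlonglongrightarrow> v" and v: "v \<in> Fix T" and var: "\<And>q. q \<in> Fix T \<Longrightarrow> inner v (v - q) \<le> 0"
    using browder_curve[OF T Fix_ne] by blast
  have proj: "metric_proj (Fix T) 0 = v"
    using var by (intro metric_proj_eqI v) (simp add: inner_diff_right)
  obtain M where M: "\<And>n. norm (X n) \<le> M" "\<And>n. norm (w n) \<le> M" "\<And>n. norm (T (w n) - w n) \<le> M"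
    using bounded_iterates by blast
  have limsup: "eventually (\<lambda>n. inner v (v - w n) \<le> \<epsilon>) sequentially" if "0 < \<epsilon>" for \<epsilon>
  proof -
    have "(\<lambda>k. norm (V k - v) * (norm (V k) + M + norm v)) \<longlonglongrightarrow> norm (v - v) * (norm v + M + norm v)"
      by (intro tendsto_intros Vlim)
    then have "eventually (\<lambda>k. norm (V k - v) * (norm (V k) + M + norm v) < \<epsilon> / 2) sequentially"
      using that by (intro order_tendstoD(2)) auto
    \<comment> \<open>The curve index \<open>k\<close> is fixed before \<open>n\<close> grows, so
      that the factor \<open>Suc k\<close> in \<open>?h\<close> is a constant times a vanishing
      residual.\<close>
    then obtain k where k: "norm (V k - v) * (norm (V k) + M + norm v) < \<epsilon> / 2"
      by (auto simp: eventually_sequentially)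
    let ?h = "\<lambda>n. real (Suc k) * (norm (T (w n) - w n) * (M + norm (V k)))"
    have "?h \<longlonglongrightarrow> 0"
      by (intro tendsto_mult_right_zero tendsto_mult_left_zero tendsto_norm_zero residual_tendsto_zero)
    then have "eventually (\<lambda>n. ?h n < \<epsilon> / 2) sequentially"
      by (rule order_tendstoD(2)) (use that in simp)
    then show ?thesis
    proof eventually_elim
      case (elim n)
      \<comment> \<open>Monotonicity of \<open>I - T\<close> between \<open>w n\<close> and the
        curve point, where \<open>V k - T (V k)\<close> is a negative multiple of
        \<open>V k\<close>.\<close>
      have "0 \<le> inner ((w n - T (w n)) - (V k - T (V k))) (w n - V k)"
        by (rule nonexpansive_id_minus_monotone[OF T])
      also have "(w n - T (w n)) - (V k - T (V k)) = inverse (real (Suc k)) *\<^sub>R V k - (T (w n) - w n)"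
        using V[of k] by (simp add: algebra_simps)
      finally have "inverse (real (Suc k)) * inner (V k) (V k - w n) \<le> - inner (T (w n) - w n) (w n - V k)"
        by (simp add: inner_diff_left inner_diff_right algebra_simps)
      also have "\<dots> \<le> norm (T (w n) - w n) * norm (w n - V k)"
        using Cauchy_Schwarz_ineq2[of "T (w n) - w n" "w n - V k"] by linarith
      also have "\<dots> \<le> norm (T (w n) - w n) * (M + norm (V k))"
        using norm_triangle_ineq4[of "w n" "V k"] M(2)[of n] by (intro mult_left_mono) auto
      finally have "inner (V k) (V k - w n) \<le> ?h n"
        by (simp add: field_simps)
      moreover have "inner v (v - w n) = inner (V k) (V k - w n) - inner (V k - v) (V k - w n + v)"
        by (simp add: inner_diff_left inner_diff_right inner_add_right inner_commute)
      moreover have "- inner (V k - v) (V k - w n + v) \<le> norm (V k - v) * norm (V k - w n + v)"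
        using Cauchy_Schwarz_ineq2[of "V k - v" "V k - w n + v"] by linarith
      moreover have "\<dots> \<le> norm (V k - v) * (norm (V k) + M + norm v)"
        using norm_triangle_ineq[of "V k - w n" v] norm_triangle_ineq4[of "V k" "w n"] M(2)[of n]
        by (intro mult_left_mono) auto
      ultimately show ?case using elim k by linarith
    qed
  qed
  have "(\<lambda>n. (norm (X n - v))\<^sup>2) \<longlonglongrightarrow> 0"
  proof (rule recursive_ineq_tendsto_zero[where \<alpha> = "\<lambda>n. 1 - e n"
        and \<beta> = "\<lambda>n. 2 * inner v (v - w n)" and d = "\<lambda>_. 0"])
    show "eventually (\<lambda>n. 2 * inner v (v - w n) \<le> \<epsilon>) sequentially" if "0 < \<epsilon>" for \<epsilon>
      using limsup[of "\<epsilon> / 2"] that by (auto elim: eventually_mono)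
    fix n
    have sq: "(norm (X (Suc n) - v))\<^sup>2 \<le> (norm (w n - v))\<^sup>2"
      by (intro power_mono X_Suc_norm_le v) simp
    have "w n - v = e n *\<^sub>R (X n - v) - (1 - e n) *\<^sub>R v"
      by (simp add: w_eq algebra_simps)
    \<comment> \<open>With \<open>b = (1 - e n) v\<close> the inner product supplies the
      \<beta>-term of the recursion, its weight \<open>1 - e n\<close> being the
      \<alpha>-term.\<close>
    moreover have "(norm (a - b))\<^sup>2 \<le> (norm a)\<^sup>2 - 2 * inner b (a - b)" for a b :: 'a
      using zero_le_power2[of "norm b"]
      by (simp add: power2_norm_eq_inner inner_diff_left inner_diff_right inner_commute)
    ultimately have "(norm (w n - v))\<^sup>2 \<le> (e n * norm (X n - v))\<^sup>2 - 2 * ((1 - e n) * inner v (w n - v))"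
      using e(1)[of n] by (metis abs_of_pos inner_scaleR_left norm_scaleR)
    also have "\<dots> \<le> e n * (norm (X n - v))\<^sup>2 - 2 * ((1 - e n) * inner v (w n - v))"
      using e[of n] by (simp add: power_mult_distrib power2_eq_square[of "e n"] mult_right_mono)
    finally have "(norm (w n - v))\<^sup>2
        \<le> e n * (norm (X n - v))\<^sup>2 - 2 * ((1 - e n) * inner v (w n - v))" .
    from order_trans[OF sq this] show "(norm (X (Suc n) - v))\<^sup>2
        \<le> (1 - (1 - e n)) * (norm (X n - v))\<^sup>2 + (1 - e n) * (2 * inner v (v - w n)) + 0"
      by (simp add: inner_diff_right algebra_simps)
  qed (use e e_div in \<open>auto intro: less_imp_le\<close>)
  then have "(\<lambda>n. norm (X n - v)) \<longlonglongrightarrow> 0"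
    using tendsto_real_sqrt by fastforce
  then have X: "X \<longlonglongrightarrow> v" by (rule LIM_zero_cancel[OF tendsto_norm_zero_cancel])
  then show "X \<longlonglongrightarrow> metric_proj (Fix T) 0" by (simp add: proj)
  show "w \<longlonglongrightarrow> metric_proj (Fix T) 0"
    using tendsto_add[OF w_minus_X X] by (simp add: proj)
  show "metric_proj (Fix T) 0 \<in> Fix T" using v by (simp add: proj)
qed

end

section \<open>Zeros of a sum and fixed points of the reflected resolvents\<close>

text \<open>For a zero \<open>p\<close> with \<open>b\<close> in \<open>B p\<close> and
  \<open>- b\<close> in \<open>A p\<close>, the two reflections exchange
  \<open>p + \<gamma> b\<close> and \<open>p - \<gamma> b\<close>.\<close>

lemma Fix_reflected_resolvents_nonempty:
  fixes A B :: "'a::{real_inner, banach} operator"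
  assumes "maximally_monotone A" "maximally_monotone B" "Zer (op_add A B) \<noteq> {}" "\<gamma> > 0"
  shows "Fix (reflected_resolvent (op_scale \<gamma> A) \<circ> reflected_resolvent (op_scale \<gamma> B)) \<noteq> {}"
proof -
  let ?A = "op_scale \<gamma> A" and ?B = "op_scale \<gamma> B"
  have A: "maximally_monotone ?A" and B: "maximally_monotone ?B"
    using assms by (auto intro: maximally_monotone_op_scale)
  obtain p a b where ab: "a \<in> A p" "b \<in> B p" "a + b = 0"
    using assms(3) by (force simp: Zer_def op_add_def set_plus_def)
  have "resolvent ?B (p + \<gamma> *\<^sub>R b) = p"
    unfolding resolvent_eq_iff[OF B] using ab(2) by (auto simp: op_scale_def)
  then have RB: "reflected_resolvent ?B (p + \<gamma> *\<^sub>R b) = p - \<gamma> *\<^sub>R b"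
    by (simp add: reflected_resolvent_def scaleR_2)
  have "a = - b" using ab(3) by (simp add: eq_neg_iff_add_eq_0)
  then have "resolvent ?A (p - \<gamma> *\<^sub>R b) = p"
    unfolding resolvent_eq_iff[OF A] using ab(1) by (auto simp: op_scale_def intro!: image_eqI[of _ _ a])
  then have "reflected_resolvent ?A (p - \<gamma> *\<^sub>R b) = p + \<gamma> *\<^sub>R b"
    by (simp add: reflected_resolvent_def scaleR_2)
  with RB have "p + \<gamma> *\<^sub>R b \<in> Fix (reflected_resolvent ?A \<circ> reflected_resolvent ?B)"
    by (simp add: Fix_def)
  then show ?thesis by blast
qed

text \<open>At a fixed point both resolvents return the same \<open>p\<close>, and their inclusions
  put \<open>p - v\<close> and \<open>v - p\<close> into the two scaled operators at
  \<open>p\<close>; these cancel.\<close>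

lemma resolvent_fixed_point_in_Zer:
  fixes A B :: "'a::{real_inner, banach} operator"
  assumes "maximally_monotone A" "maximally_monotone B" "\<gamma> > 0"
    and v: "v \<in> Fix (reflected_resolvent (op_scale \<gamma> A) \<circ> reflected_resolvent (op_scale \<gamma> B))"
  shows "resolvent (op_scale \<gamma> B) v \<in> Zer (op_add A B)"
proof -
  let ?A = "op_scale \<gamma> A" and ?B = "op_scale \<gamma> B"
  have A: "maximally_monotone ?A" and B: "maximally_monotone ?B"
    using assms by (auto intro: maximally_monotone_op_scale)
  define p where "p = resolvent ?B v"
  have "2 *\<^sub>R resolvent ?A (2 *\<^sub>R p - v) = 2 *\<^sub>R p"
    using v by (simp add: Fix_def reflected_resolvent_def p_def algebra_simps)
  then have "resolvent ?A (2 *\<^sub>R p - v) = p" by simp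
  then have "p - v \<in> ?A p"
    unfolding resolvent_eq_iff[OF A] by (simp add: scaleR_2)
  then obtain a where a: "a \<in> A p" "p - v = \<gamma> *\<^sub>R a" by (auto simp: op_scale_def)
  obtain b where b: "b \<in> B p" "v - p = \<gamma> *\<^sub>R b"
    using resolvent_mem[OF B, of v] by (auto simp: op_scale_def p_def)
  have "\<gamma> *\<^sub>R (a + b) = 0" using a(2) b(2) by (simp add: scaleR_add_right flip: a(2) b(2))
  then have "a + b = 0" using assms(3) by simp
  then show ?thesis
    using a(1) b(1) unfolding Zer_def op_add_def p_def[symmetric]
    by (metis (mono_tags, lifting) mem_Collect_eq set_plus_intro)
qed

theorem theorem5p1:
  fixes A B :: "'a::{real_inner, banach} operator"
    and x y z u :: "nat \<Rightarrow> 'a"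
    and e \<theta> :: "nat \<Rightarrow> real"
    and \<gamma> \<Theta>_lo \<Theta>_up :: real
  assumes "maximally_monotone A" and "maximally_monotone B"
    and "Zer (op_add A B) \<noteq> {}"
    and "\<gamma> > 0"
    and "\<And>n. n \<ge> 1 \<Longrightarrow> y n = resolvent (op_scale \<gamma> B) (e n *\<^sub>R x n)"
    and "\<And>n. n \<ge> 1 \<Longrightarrow> z n = resolvent (op_scale \<gamma> A) (2 *\<^sub>R y n - e n *\<^sub>R x n)"
    and "\<And>n. n \<ge> 1 \<Longrightarrow> u n = e n *\<^sub>R x n + \<theta> n *\<^sub>R (z n - y n)"
    and "\<And>n. n \<ge> 1 \<Longrightarrow> x (n + 1) =
           reflected_resolvent (op_scale \<gamma> A) (reflected_resolvent (op_scale \<gamma> B) (u n))"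
    and "\<And>n. n \<ge> 1 \<Longrightarrow> e n \<in> {0<..<1}"
    and "\<And>n. n \<ge> 1 \<Longrightarrow> \<theta> n \<in> {0<..2}"
    and "e \<longlonglongrightarrow> 1"
    and "filterlim (\<lambda>N. \<Sum>n=1..N. 1 - e n) at_top sequentially"
    and "summable (\<lambda>n. \<bar>e (n + 2) - e (n + 1)\<bar>)"
    and "0 < \<Theta>_lo" and "\<Theta>_up < 1"
    and "\<And>n. n \<ge> 1 \<Longrightarrow> \<Theta>_lo \<le> \<theta> n / 2 \<and> \<theta> n / 2 \<le> \<Theta>_up"
    and "summable (\<lambda>n. \<bar>\<theta> (n + 2) - \<theta> (n + 1)\<bar>)"
  defines "xbar \<equiv> metric_proj
      (Fix (reflected_resolvent (op_scale \<gamma> A) \<circ> reflected_resolvent (op_scale \<gamma> B))) 0"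
  shows "x \<longlonglongrightarrow> xbar \<and>
         y \<longlonglongrightarrow> resolvent (op_scale \<gamma> B) xbar \<and>
         z \<longlonglongrightarrow> resolvent (op_scale \<gamma> B) xbar \<and>
         resolvent (op_scale \<gamma> B) xbar \<in> Zer (op_add A B)"
proof -
  let ?A = "op_scale \<gamma> A" and ?B = "op_scale \<gamma> B"
  define T where "T = reflected_resolvent ?A \<circ> reflected_resolvent ?B"
  \<comment> \<open>The scheme starts at index 1, so every sequence is shifted by one to fit the
    locale.\<close>
  define X where "X n = x (Suc n)" for n
  define w where "w n = e (Suc n) *\<^sub>R x (Suc n)" for n
  have A: "maximally_monotone ?A" and B: "maximally_monotone ?B"
    using assms(1,2,4) by (auto intro: maximally_monotone_op_scale)
  \<comment> \<open>Here \<open>T w = 2 z - (2 y - w)\<close>; the factor 1/2 is why the relaxation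
    parameter becomes \<theta>/2.\<close>
  have z_minus_y: "z (Suc n) - y (Suc n) = (1/2) *\<^sub>R (T (w n) - w n)" for n
  proof -
    have "y (Suc n) = resolvent ?B (w n)" "z (Suc n) = resolvent ?A (2 *\<^sub>R y (Suc n) - w n)"
      using assms(5,6)[of "Suc n"] by (auto simp: w_def)
    then show ?thesis by (simp add: T_def reflected_resolvent_def algebra_simps flip: scaleR_add_left)
  qed
  interpret anchored_iteration T X w "\<lambda>n. e (Suc n)" "\<lambda>n. \<theta> (Suc n) / 2" \<Theta>_lo \<Theta>_up
  proof
    show "norm (T a - T b) \<le> norm (a - b)" for a b
      unfolding T_def o_def
      by (rule order_trans[OF reflected_resolvent_nonexpansive[OF A] reflected_resolvent_nonexpansive[OF B]])
    show "Fix T \<noteq> {}"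
      using Fix_reflected_resolvents_nonempty[OF assms(1-4)] by (simp add: T_def)
    show "w n = e (Suc n) *\<^sub>R X n" for n by (simp add: w_def X_def)
    show "X (Suc n) = T (w n + (\<theta> (Suc n) / 2) *\<^sub>R (T (w n) - w n))" for n
      using assms(7,8)[of "Suc n"] z_minus_y[of n] by (simp add: X_def T_def w_def)
    show "(\<lambda>n. e (Suc n)) \<longlonglongrightarrow> 1" using assms(11) by (rule LIMSEQ_Suc)
    show "filterlim (\<lambda>n. \<Sum>k<n. 1 - e (Suc k)) at_top sequentially"
      using assms(12) by (simp add: sum.atLeast1_atMost_eq)
    show "summable (\<lambda>n. \<bar>e (Suc (Suc n)) - e (Suc n)\<bar>)" using assms(13) by simp
    have "summable (\<lambda>n. \<bar>\<theta> (n + 2) - \<theta> (n + 1)\<bar> / 2)" using assms(17) by (rule summable_divide)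
    then show "summable (\<lambda>n. \<bar>\<theta> (Suc (Suc n)) / 2 - \<theta> (Suc n) / 2\<bar>)"
      by (simp flip: diff_divide_distrib)
  qed (use assms(9,14-16) in auto)
  have xbar: "metric_proj (Fix T) 0 = xbar" by (simp add: xbar_def T_def)
  note X = converges(1)[unfolded xbar] and w = converges(2)[unfolded xbar]
    and fixed = converges(3)[unfolded xbar]
  have "(\<lambda>n. norm (w n - xbar)) \<longlonglongrightarrow> 0" using w by (intro tendsto_norm_zero LIM_zero)
  then have "(\<lambda>n. y (Suc n) - resolvent ?B xbar) \<longlonglongrightarrow> 0"
    by (rule Lim_null_comparison[rotated])
      (use assms(5) resolvent_nonexpansive[OF B] in \<open>auto simp: w_def\<close>)
  then have y: "(\<lambda>n. y (Suc n)) \<longlonglongrightarrow> resolvent ?B xbar" by (rule LIM_zero_cancel)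
  \<comment> \<open>The sequence on the left is \<open>z\<close>: it differs from \<open>y\<close>
    by half the vanishing residual, so both share one limit.\<close>
  have "(\<lambda>n. y (Suc n) + (1/2) *\<^sub>R (T (w n) - w n)) \<longlonglongrightarrow> resolvent ?B xbar + (1/2) *\<^sub>R 0"
    by (intro tendsto_intros y residual_tendsto_zero)
  then have z: "(\<lambda>n. z (Suc n)) \<longlonglongrightarrow> resolvent ?B xbar"
    by (simp flip: z_minus_y)
  have "resolvent ?B xbar \<in> Zer (op_add A B)"
    using resolvent_fixed_point_in_Zer[OF assms(1,2,4)] fixed by (simp add: T_def)
  then show ?thesis
    using X y z LIMSEQ_imp_Suc[of x xbar] LIMSEQ_imp_Suc[of y] LIMSEQ_imp_Suc[of z] by (simp add: X_def[abs_def])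
qed

end
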